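(* Define sequences $(x_i)_{i\ge1}$, $(b_i)_{i\ge1}$, $(l_i)_{i\ge1}$ by: for $1\le i\le 5$, $x_i=(0,1)$, $b_i=2$, $l_i=0$; for $i\ge 6$, $x_i=P_{i,i^2}$, $b_i=2^i$, $l_i=2^{4i^2}$. Let $Q=(q_n)$ and $x$ be the basic sequence and real number associated with $(l_i),(b_i),(x_i)$ as described in the context. Then $\lim_{n\to\infty}T_{Q,n}(x)=0$, where $T_{Q,n}(x)=q_1q_2\cdots q_n\,x \pmod 1$.
   Context: A block of length $k$ is a $k$-tuple of non-negative integers; $|B|$ denotes its length. For a positive integer $b$, define $\nu_b(j)=2^{-b}$ for $0\le j\le b-1$, $\nu_b(b)=(2^b-b)/2^b$, $\nu_b(j)=0$ for $j>b$, and $\nu_b(c_1,\dots,c_k)=\prod_{j}\nu_b(c_j)$. For positive integers $b,w$, let $P_1,\dots,P_{(b+1)^w}$ be all blocks of length $w$ with digits in $\{0,\dots,b\}$ in lexicographic order, and let $P_{b,w}$ be the concatenation of $2^{bw}\nu_b(P_1)$ copies of $P_1$, then $2^{bw}\nu_b(P_2)$ copies of $P_2$, etc., up to $P_{(b+1)^w}$ (these multiplicities are the integers $(2^b-b)^{g}$, $g$ = number of digits equal to $b$). Associated $Q$ and $x$: put $L_0=0$, $L_i=\sum_{j=1}^i l_j|x_j|$, $q_n=b_i$ for $L_{i-1}<n\le L_i$, $Q=(q_n)_{n\ge1}$; let $(E_1,E_2,\dots)$ be the infinite sequence formed by concatenating $l_1$ copies of $x_1$, then $l_2$ copies of $x_2$,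 etc.; and $x=\sum_{n\ge1}E_n/(q_1\cdots q_n)$. *)

theory Defs
  imports Complex_Main "HOL-Library.List_Lexorder"
begin

type_synonym block = "nat list"

definition nu :: "nat \<Rightarrow> nat \<Rightarrow> real" where
  "nu b j = (if j < b then 1 / 2 ^ b else if j = b then (2 ^ b - real b) / 2 ^ b else 0)"

definition nu_block :: "nat \<Rightarrow> block \<Rightarrow> real" where
  "nu_block b B = (\<Prod>c\<leftarrow>B. nu b c)"

text \<open>The order on lists is the one of \<^theory>\<open>HOL-Library.List_Lexorder\<close>, so this is the list
  of all blocks of length \<open>w\<close> with digits in \<open>{0..b}\<close> in lexicographic order.\<close>

definition blocks_lex :: "nat \<Rightarrow> nat \<Rightarrow> block list" where
  "blocks_lex b w = sorted_list_of_set {B. length B = w \<and> set B \<subseteq> {0..b}}"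

text \<open>The floor below does not round anything on the blocks it is applied to:
  see \<open>of_nat_multiplicity\<close>.\<close>

definition multiplicity_P :: "nat \<Rightarrow> nat \<Rightarrow> block \<Rightarrow> nat" where
  "multiplicity_P b w B = nat \<lfloor>2 ^ (b * w) * nu_block b B\<rfloor>"

definition P_block :: "nat \<Rightarrow> nat \<Rightarrow> block" where
  "P_block b w = concat (map (\<lambda>B. concat (replicate (multiplicity_P b w B) B)) (blocks_lex b w))"

lemma scaled_nu_block:
  assumes "set B \<subseteq> {0..b}"
  shows "2 ^ (b * length B) * nu_block b B = real ((2 ^ b - b) ^ length (filter (\<lambda>c. c = b) B))"
  using assms
proof (induction B)
  case Nil
  then show ?case by (simp add: nu_block_def)
next
  case (Cons c B)
  have le: "b \<le> 2 ^ b" by (simp add: less_imp_le)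
  have 1: "2 ^ b * nu b c = real (if c = b then 2 ^ b - b else 1)"
    using Cons.prems le by (auto simp: nu_def of_nat_diff)
  have "2 ^ (b * length (c # B)) * nu_block b (c # B) =
      (2 ^ b * nu b c) * (2 ^ (b * length B) * nu_block b B)"
    by (simp add: nu_block_def power_add)
  also have "\<dots> = real (if c = b then 2 ^ b - b else 1)
      * real ((2 ^ b - b) ^ length (filter (\<lambda>c. c = b) B))"
    using Cons 1 by simp
  finally show ?case by auto
qed

lemma multiplicity_P_eq:
  assumes "length B = w" "set B \<subseteq> {0..b}"
  shows "multiplicity_P b w B = (2 ^ b - b) ^ length (filter (\<lambda>c. c = b) B)"
  using scaled_nu_block[OF assms(2)] assms(1) unfolding multiplicity_P_def
  by (metis floor_of_nat nat_int)

lemma of_nat_multiplicity: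
  assumes "length B = w" "set B \<subseteq> {0..b}"
  shows "real (multiplicity_P b w B) = 2 ^ (b * w) * nu_block b B"
  using scaled_nu_block[OF assms(2)] multiplicity_P_eq[OF assms] assms(1) by simp

text \<open>Below, all sequences are indexed from 1; their values at 0 are irrelevant.\<close>

definition L_sum :: "(nat \<Rightarrow> nat) \<Rightarrow> (nat \<Rightarrow> block) \<Rightarrow> nat \<Rightarrow> nat" where
  "L_sum l X i = (\<Sum>j=1..i. l j * length (X j))"

definition stage :: "(nat \<Rightarrow> nat) \<Rightarrow> (nat \<Rightarrow> block) \<Rightarrow> nat \<Rightarrow> nat" where
  "stage l X n = (THE i. 1 \<le> i \<and> L_sum l X (i - 1) < n \<and> n \<le> L_sum l X i)"

definition assoc_Q :: "(nat \<Rightarrow> nat) \<Rightarrow> (nat \<Rightarrow> nat) \<Rightarrow> (nat \<Rightarrow> block) \<Rightarrow> nat \<Rightarrow> nat" where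
  "assoc_Q l b X n = b (stage l X n)"

definition concat_upto :: "(nat \<Rightarrow> nat) \<Rightarrow> (nat \<Rightarrow> block) \<Rightarrow> nat \<Rightarrow> block" where
  "concat_upto l X i = concat (map (\<lambda>j. concat (replicate (l j) (X j))) [1..<Suc i])"

text \<open>The infinite concatenation is read off its finite initial segments, which have length
  \<open>L_sum l X i\<close>; list positions start at 0.\<close>

definition assoc_E :: "(nat \<Rightarrow> nat) \<Rightarrow> (nat \<Rightarrow> block) \<Rightarrow> nat \<Rightarrow> nat" where
  "assoc_E l X n = concat_upto l X (stage l X n) ! (n - 1)"

lemma length_concat_upto: "length (concat_upto l X i) = L_sum l X i"
  by (induction i) (simp_all add: concat_upto_def L_sum_def length_concat sum_list_replicate)

definition assoc_x :: "(nat \<Rightarrow> nat) \<Rightarrow> (nat \<Rightarrow> nat) \<Rightarrow> (nat \<Rightarrow> block) \<Rightarrow> real" where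
  "assoc_x l b X =
     (\<Sum>n. real (assoc_E l X (Suc n)) / (\<Prod>m=1..Suc n. real (assoc_Q l b X m)))"

definition T_map :: "(nat \<Rightarrow> nat) \<Rightarrow> nat \<Rightarrow> real \<Rightarrow> real" where
  "T_map Q n x = frac ((\<Prod>m=1..n. real (Q m)) * x)"

end

theory Submission
  imports Defs
begin

text \<open>Up to an integer, \<open>q\<^sub>1\<cdots>q\<^sub>n x\<close> is the tail
  \<open>\<Sum>\<^sub>k E\<^sub>n\<^sub>+\<^sub>k / (q\<^sub>n\<^sub>+\<^sub>1\<cdots>q\<^sub>n\<^sub>+\<^sub>k)\<close>, which is itself the Cantor series of the
  shifted digits and bases. Since all \<open>q\<^sub>m \<ge> 2\<close>, a bound \<open>E\<^sub>m / q\<^sub>m \<le> e\<close> for \<open>m > n\<close> compares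
  this tail with the geometric series of sum \<open>2 e\<close>. At stage \<open>i\<close> the digits are at most \<open>i\<close>
  whereas the bases are \<open>2\<^sup>i\<close>, so \<open>E\<^sub>m / q\<^sub>m \<longlonglongrightarrow> 0\<close>.\<close>

definition basic_sequence :: "(nat \<Rightarrow> nat) \<Rightarrow> bool" where
  "basic_sequence q \<longleftrightarrow> (\<forall>m\<ge>1. 2 \<le> q m)"

definition base_prod :: "(nat \<Rightarrow> nat) \<Rightarrow> nat \<Rightarrow> real" where
  "base_prod q n = (\<Prod>m=1..n. real (q m))"

definition cantor_series :: "(nat \<Rightarrow> nat) \<Rightarrow> (nat \<Rightarrow> nat) \<Rightarrow> real" where
  "cantor_series q E = (\<Sum>k. real (E (Suc k)) / base_prod q (Suc k))"

definition cantor_tail :: "(nat \<Rightarrow> nat) \<Rightarrow> (nat \<Rightarrow> nat) \<Rightarrow> nat \<Rightarrow> real" where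
  "cantor_tail q E n = cantor_series (\<lambda>m. q (n + m)) (\<lambda>m. E (n + m))"

lemma basic_sequence_shift: "basic_sequence q \<Longrightarrow> basic_sequence (\<lambda>m. q (n + m))"
  by (simp add: basic_sequence_def)

lemma base_prod_0 [simp]: "base_prod q 0 = 1"
  by (simp add: base_prod_def)

lemma base_prod_Suc: "base_prod q (Suc n) = base_prod q n * real (q (Suc n))"
  by (simp add: base_prod_def)

lemma base_prod_add: "base_prod q (n + k) = base_prod q n * base_prod (\<lambda>m. q (n + m)) k"
  by (induction k) (simp_all add: base_prod_Suc)

lemma base_prod_in_Ints: "base_prod q n \<in> \<int>"
  unfolding base_prod_def by (intro Ints_prod Ints_of_nat)

lemma base_prod_ge_power2:
  assumes "basic_sequence q"
  shows "2 ^ n \<le> base_prod q n"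
proof -
  have "(\<Prod>m=1..n. 2) \<le> base_prod q n"
    unfolding base_prod_def using assms by (intro prod_mono) (simp add: basic_sequence_def)
  then show ?thesis by simp
qed

lemma base_prod_pos: "basic_sequence q \<Longrightarrow> 0 < base_prod q n"
  by (rule less_le_trans[OF _ base_prod_ge_power2]) simp

lemma base_prod_times_cantor_partial_sum_in_Ints:
  assumes basic: "basic_sequence q"
  shows "base_prod q n * (\<Sum>k<n. real (E (Suc k)) / base_prod q (Suc k)) \<in> \<int>"
  unfolding sum_distrib_left
proof (rule Ints_sum)
  fix k
  assume "k \<in> {..<n}"
  then obtain j where n_eq: "n = Suc k + j"
    by (auto dest: less_imp_Suc_add)
  have "base_prod q n * (real (E (Suc k)) / base_prod q (Suc k))
      = real (E (Suc k)) * base_prod (\<lambda>m. q (Suc k + m)) j"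
    unfolding n_eq base_prod_add using base_prod_pos[OF basic, of "Suc k"] by simp
  also have "\<dots> \<in> \<int>"
    by (intro Ints_mult Ints_of_nat base_prod_in_Ints)
  finally show "base_prod q n * (real (E (Suc k)) / base_prod q (Suc k)) \<in> \<int>" .
qed

lemma cantor_term_nonneg: "0 \<le> real (E (Suc k)) / base_prod q (Suc k)"
  by (simp add: base_prod_def prod_nonneg)

lemma cantor_term_le:
  assumes basic: "basic_sequence q"
    and digit_le: "\<And>k. real (E (Suc k)) / real (q (Suc k)) \<le> e"
  shows "real (E (Suc k)) / base_prod q (Suc k) \<le> e * (1 / 2) ^ k"
proof -
  have "real (E (Suc k)) / base_prod q (Suc k)
      = real (E (Suc k)) / real (q (Suc k)) * (1 / base_prod q k)"
    by (simp add: base_prod_Suc)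
  also have "\<dots> \<le> e * (1 / 2 ^ k)"
  proof (rule mult_mono)
    show "1 / base_prod q k \<le> 1 / 2 ^ k"
      by (simp add: base_prod_ge_power2[OF basic] base_prod_pos[OF basic] frac_le)
    show "0 \<le> e"
      by (rule order_trans[OF _ digit_le[of k]]) simp
  qed (simp_all add: digit_le base_prod_pos[OF basic] less_imp_le)
  finally show ?thesis
    by (simp add: power_one_over)
qed

lemma half_power_sums: "(\<lambda>k. e * (1 / 2) ^ k) sums (2 * e)" for e :: real
  using sums_mult[OF geometric_sums[of "1 / 2 :: real"], of e] by (simp add: mult.commute)

lemma summable_cantor_series:
  assumes "basic_sequence q" "\<And>k. real (E (Suc k)) / real (q (Suc k)) \<le> e"
  shows "summable (\<lambda>k. real (E (Suc k)) / base_prod q (Suc k))"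
proof (rule summable_comparison_test'[OF sums_summable[OF half_power_sums]])
  show "norm (real (E (Suc k)) / base_prod q (Suc k)) \<le> e * (1 / 2) ^ k" if "0 \<le> k" for k
    using cantor_term_le[OF assms]
    by (simp only: real_norm_def abs_of_nonneg[OF cantor_term_nonneg])
qed

lemma cantor_series_bounds:
  assumes "basic_sequence q" "\<And>k. real (E (Suc k)) / real (q (Suc k)) \<le> e"
  shows "0 \<le> cantor_series q E" "cantor_series q E \<le> 2 * e"
proof -
  have sums: "(\<lambda>k. real (E (Suc k)) / base_prod q (Suc k)) sums cantor_series q E"
    unfolding cantor_series_def using summable_cantor_series[OF assms] by (rule summable_sums)
  show "0 \<le> cantor_series q E"
    using cantor_term_nonneg sums_zero sums by (rule sums_le)
  show "cantor_series q E \<le> 2 * e"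
    using cantor_term_le[OF assms] sums half_power_sums by (rule sums_le)
qed

lemma cantor_tail_bounds:
  assumes "basic_sequence q" "\<And>m. n < m \<Longrightarrow> real (E m) / real (q m) \<le> e"
  shows "0 \<le> cantor_tail q E n" "cantor_tail q E n \<le> 2 * e"
  unfolding cantor_tail_def
  by (rule cantor_series_bounds[where e = e]; simp add: assms basic_sequence_shift)+

lemma base_prod_times_cantor_series:
  assumes basic: "basic_sequence q"
    and digit_le: "\<And>k. real (E (Suc k)) / real (q (Suc k)) \<le> e"
  shows "base_prod q n * cantor_series q E
    = base_prod q n * (\<Sum>k<n. real (E (Suc k)) / base_prod q (Suc k))
      + cantor_tail q E n"
proof -
  define a where "a k = real (E (Suc k)) / base_prod q (Suc k)" for k
  have summable_a: "summable a"
    unfolding a_def using basic digit_le by (rule summable_cantor_series)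
  have "base_prod q n * a (k + n)
      = real (E (n + Suc k)) / base_prod (\<lambda>m. q (n + m)) (Suc k)" for k
    using base_prod_add[of q n "Suc k"] base_prod_pos[OF basic, of n]
    by (simp add: a_def add.commute)
  then have "base_prod q n * (\<Sum>k. a (k + n)) = cantor_tail q E n"
    unfolding cantor_tail_def cantor_series_def
    by (simp flip: suminf_mult[OF summable_ignore_initial_segment[OF summable_a]])
  moreover have "cantor_series q E = (\<Sum>k. a (k + n)) + (\<Sum>k<n. a k)"
    unfolding cantor_series_def a_def[symmetric]
    by (rule suminf_split_initial_segment[OF summable_a])
  ultimately show ?thesis
    by (simp add: a_def distrib_left)
qed

lemma T_map_cantor_series:
  assumes "basic_sequence q" "\<And>k. real (E (Suc k)) / real (q (Suc k)) \<le> e"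
  shows "T_map q n (cantor_series q E) = frac (cantor_tail q E n)"
proof -
  have "T_map q n (cantor_series q E) = frac (base_prod q n * cantor_series q E)"
    by (simp add: T_map_def base_prod_def)
  also have "\<dots> = frac (cantor_tail q E n)"
    unfolding base_prod_times_cantor_series[OF assms]
    by (intro frac_add_int_left base_prod_times_cantor_partial_sum_in_Ints assms(1))
  finally show ?thesis .
qed

lemma cantor_tail_tendsto_0:
  assumes basic: "basic_sequence q"
    and lim: "(\<lambda>m. real (E m) / real (q m)) \<longlonglongrightarrow> 0"
  shows "cantor_tail q E \<longlonglongrightarrow> 0"
proof (rule LIMSEQ_I)
  fix r :: real
  assume "0 < r"
  then obtain N where digit_le_from_N: "\<And>m. N \<le> m \<Longrightarrow> real (E m) / real (q m) \<le> r / 3"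
    using LIMSEQ_D[OF lim, of "r / 3"] by (auto intro: less_imp_le)
  have "norm (cantor_tail q E n - 0) < r" if "N \<le> n" for n
  proof -
    have "real (E m) / real (q m) \<le> r / 3" if "n < m" for m
      using \<open>N \<le> n\<close> that by (intro digit_le_from_N) simp
    then show ?thesis
      using cantor_tail_bounds[OF basic, of n E "r / 3"] \<open>0 < r\<close> by simp
  qed
  then show "\<exists>N. \<forall>n\<ge>N. norm (cantor_tail q E n - 0) < r"
    by blast
qed

lemma T_map_cantor_series_tendsto_0:
  assumes basic: "basic_sequence q"
    and lim: "(\<lambda>m. real (E m) / real (q m)) \<longlonglongrightarrow> 0"
  shows "(\<lambda>n. T_map q n (cantor_series q E)) \<longlonglongrightarrow> 0"
proof -
  obtain e where digit_le: "\<And>m. real (E m) / real (q m) \<le> e"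
    using convergent_imp_Bseq[OF convergentI[OF lim]] unfolding Bseq_def by auto
  have "T_map q n (cantor_series q E) \<le> cantor_tail q E n" for n
    using cantor_tail_bounds(1)[OF basic digit_le, of n]
    by (simp add: T_map_cantor_series[OF basic digit_le] frac_def)
  then show ?thesis
    by (intro tendsto_sandwich[OF _ _ tendsto_const cantor_tail_tendsto_0[OF basic lim]])
      (simp_all add: T_map_def)
qed

lemma L_sum_0 [simp]: "L_sum l X 0 = 0"
  by (simp add: L_sum_def)

lemma L_sum_Suc: "L_sum l X (Suc i) = L_sum l X i + l (Suc i) * length (X (Suc i))"
  by (simp add: L_sum_def)

lemma mono_L_sum: "mono (L_sum l X)"
  by (simp add: mono_iff_le_Suc L_sum_Suc)

lemma L_sum_less_imp_less: "L_sum l X i < L_sum l X j \<Longrightarrow> i < j"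
  by (rule mono_strict_invE[OF mono_L_sum])

lemma filterlim_L_sum_at_top:
  assumes "\<forall>\<^sub>F i in sequentially. 0 < l i \<and> X i \<noteq> []"
  shows "filterlim (L_sum l X) at_top sequentially"
proof -
  obtain k where nonempty: "\<And>i. k \<le> i \<Longrightarrow> 0 < l i \<and> X i \<noteq> []"
    using assms unfolding eventually_sequentially by blast
  have "n - k \<le> L_sum l X n" for n
  proof (induction n)
    case (Suc n)
    show ?case
    proof (cases "k \<le> n")
      case True
      then have "0 < l (Suc n) * length (X (Suc n))"
        using nonempty[of "Suc n"] by simp
      with Suc show ?thesis
        unfolding L_sum_Suc by linarith
    next
      case False
      then show ?thesis by simp
    qed
  qed simp
  then show ?thesis
    by (intro filterlim_at_top_mono[OF filterlim_minus_const_nat_at_top[of k]] always_eventually allI)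
qed

lemma stage_eqI:
  assumes "1 \<le> i" "L_sum l X (i - 1) < n" "n \<le> L_sum l X i"
  shows "stage l X n = i"
  unfolding stage_def
proof (rule the_equality)
  fix j
  assume j: "1 \<le> j \<and> L_sum l X (j - 1) < n \<and> n \<le> L_sum l X j"
  then have "j - 1 < i" "i - 1 < j"
    using assms by (meson L_sum_less_imp_less less_le_trans)+
  with \<open>1 \<le> i\<close> show "j = i"
    by linarith
qed (use assms in simp)

lemma stage_bounds:
  assumes unbounded: "filterlim (L_sum l X) at_top sequentially" and "1 \<le> n"
  shows "1 \<le> stage l X n" "L_sum l X (stage l X n - 1) < n" "n \<le> L_sum l X (stage l X n)"
proof -
  define i where "i = (LEAST i. n \<le> L_sum l X i)"
  have "\<exists>i. n \<le> L_sum l X i"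
    using unbounded unfolding filterlim_at_top eventually_sequentially by blast
  then have upper: "n \<le> L_sum l X i"
    unfolding i_def by (rule LeastI_ex)
  then have "1 \<le> i"
    using \<open>1 \<le> n\<close> by (cases i) auto
  then have lower: "L_sum l X (i - 1) < n"
    using not_less_Least[of "i - 1" "\<lambda>i. n \<le> L_sum l X i"] by (simp add: i_def)
  have "stage l X n = i"
    using \<open>1 \<le> i\<close> lower upper by (rule stage_eqI)
  with \<open>1 \<le> i\<close> lower upper
  show "1 \<le> stage l X n" "L_sum l X (stage l X n - 1) < n" "n \<le> L_sum l X (stage l X n)"
    by simp_all
qed

lemma filterlim_stage_at_top:
  assumes unbounded: "filterlim (L_sum l X) at_top sequentially"
  shows "filterlim (stage l X) at_top sequentially"
  unfolding filterlim_at_top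
proof
  fix i
  show "\<forall>\<^sub>F n in sequentially. i \<le> stage l X n"
    using eventually_gt_at_top[of "L_sum l X i"]
  proof eventually_elim
    case (elim n)
    then have "L_sum l X i < L_sum l X (stage l X n)"
      using stage_bounds(3)[OF unbounded, of n] by simp
    then show ?case
      by (rule less_imp_le[OF L_sum_less_imp_less])
  qed
qed

lemma assoc_E_in_set_stage:
  assumes "filterlim (L_sum l X) at_top sequentially" "1 \<le> n"
  shows "assoc_E l X n \<in> set (X (stage l X n))"
proof -
  obtain i where stage_eq: "stage l X n = Suc i"
    using stage_bounds(1)[OF assms] by (cases "stage l X n") auto
  let ?copies = "concat (replicate (l (Suc i)) (X (Suc i)))"
  have concat_upto_Suc: "concat_upto l X (Suc i) = concat_upto l X i @ ?copies"
    by (simp add: concat_upto_def)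
  have lower: "L_sum l X i \<le> n - 1" and upper: "n - 1 < L_sum l X (Suc i)"
    using stage_bounds(2,3)[OF assms] \<open>1 \<le> n\<close> unfolding stage_eq by simp_all
  have "assoc_E l X n = ?copies ! (n - 1 - L_sum l X i)"
    using lower unfolding assoc_E_def stage_eq concat_upto_Suc
    by (simp add: nth_append length_concat_upto)
  moreover have "n - 1 - L_sum l X i < length ?copies"
    using lower upper by (simp add: L_sum_Suc length_concat sum_list_replicate)
  ultimately have "assoc_E l X n \<in> set ?copies"
    by (simp only: nth_mem)
  then show ?thesis
    unfolding stage_eq by (auto split: if_splits)
qed

lemma T_map_assoc_x_tendsto_0:
  fixes d :: "nat \<Rightarrow> real"
  assumes unbounded: "filterlim (L_sum l X) at_top sequentially"
    and base_ge: "\<And>i. 1 \<le> i \<Longrightarrow> 2 \<le> b i"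
    and digit_le: "\<And>i c. 1 \<le> i \<Longrightarrow> c \<in> set (X i) \<Longrightarrow> real c \<le> d i"
    and lim: "(\<lambda>i. d i / real (b i)) \<longlonglongrightarrow> 0"
  shows "(\<lambda>n. T_map (assoc_Q l b X) n (assoc_x l b X)) \<longlonglongrightarrow> 0"
proof -
  have basic: "basic_sequence (assoc_Q l b X)"
    using stage_bounds(1)[OF unbounded] base_ge by (simp add: basic_sequence_def assoc_Q_def)
  have stage_lim: "(\<lambda>n. d (stage l X n) / real (b (stage l X n))) \<longlonglongrightarrow> 0"
    using lim filterlim_stage_at_top[OF unbounded] by (rule filterlim_compose)
  have "(\<lambda>n. real (assoc_E l X n) / real (assoc_Q l b X n)) \<longlonglongrightarrow> 0"
  proof (rule tendsto_sandwich[OF _ _ tendsto_const stage_lim])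
    show "\<forall>\<^sub>F n in sequentially. real (assoc_E l X n) / real (assoc_Q l b X n)
        \<le> d (stage l X n) / real (b (stage l X n))"
      using eventually_ge_at_top[of 1]
      by eventually_elim
        (auto simp: assoc_Q_def intro!: divide_right_mono digit_le stage_bounds(1)[OF unbounded]
          assoc_E_in_set_stage[OF unbounded])
  qed simp
  with basic have "(\<lambda>n. T_map (assoc_Q l b X) n (cantor_series (assoc_Q l b X) (assoc_E l X)))
      \<longlonglongrightarrow> 0"
    by (rule T_map_cantor_series_tendsto_0)
  then show ?thesis
    by (simp add: assoc_x_def cantor_series_def base_prod_def)
qed

lemma set_blocks_lex: "set (blocks_lex b w) = {B. length B = w \<and> set B \<subseteq> {0..b}}"
  unfolding blocks_lex_def
  using finite_lists_length_eq[of "{0..b}" w] by (simp add: conj_commute)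

lemma multiplicity_P_pos:
  assumes "B \<in> set (blocks_lex b w)"
  shows "0 < multiplicity_P b w B"
  using assms by (simp add: set_blocks_lex multiplicity_P_eq)

lemma set_P_block:
  assumes "0 < w"
  shows "set (P_block b w) = {0..b}"
proof -
  have "set (P_block b w) = (\<Union>B\<in>set (blocks_lex b w). set B)"
    using multiplicity_P_pos[of _ b w] by (auto simp: P_block_def)
  also have "\<dots> = {0..b}"
  proof
    show "{0..b} \<subseteq> (\<Union>B\<in>set (blocks_lex b w). set B)"
    proof
      fix c
      assume "c \<in> {0..b}"
      then have "replicate w c \<in> set (blocks_lex b w)" "c \<in> set (replicate w c)"
        using assms by (auto simp: set_blocks_lex)
      then show "c \<in> (\<Union>B\<in>set (blocks_lex b w). set B)"
        by blast
    qed
  qed (auto simp: set_blocks_lex)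
  finally show ?thesis .
qed

theorem theorem4:
  fixes X :: "nat \<Rightarrow> block" and b l :: "nat \<Rightarrow> nat"
  assumes "\<And>i. 1 \<le> i \<Longrightarrow> i \<le> 5 \<Longrightarrow> X i = [0, 1] \<and> b i = 2 \<and> l i = 0"
    and "\<And>i. 6 \<le> i \<Longrightarrow> X i = P_block i (i ^ 2) \<and> b i = 2 ^ i \<and> l i = 2 ^ (4 * i ^ 2)"
  shows "(\<lambda>n. T_map (assoc_Q l b X) n (assoc_x l b X)) \<longlonglongrightarrow> 0"
proof (rule T_map_assoc_x_tendsto_0)
  have set_X: "set (X i) = {0..i}" if "6 \<le> i" for i
    using assms(2)[OF that] set_P_block[of "i\<^sup>2" i] that by simp
  show "filterlim (L_sum l X) at_top sequentially"
  proof (rule filterlim_L_sum_at_top)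
    show "\<forall>\<^sub>F i in sequentially. 0 < l i \<and> X i \<noteq> []"
      using eventually_ge_at_top[of 6]
      by eventually_elim (use assms(2) set_X in force)
  qed
  show "2 \<le> b i" if "1 \<le> i" for i
    using assms that power_increasing[of 1 i "2 :: nat"] by (cases "i \<le> 5") simp_all
  show "real c \<le> real i" if "1 \<le> i" "c \<in> set (X i)" for i c
    using assms(1)[of i] set_X[of i] that by (cases "i \<le> 5") auto
  have "(\<lambda>i. real i * (1 / 2) ^ i) \<longlonglongrightarrow> 0"
    by (rule powser_times_n_limit_0) simp
  moreover have "\<forall>\<^sub>F i in sequentially. real i * (1 / 2) ^ i = real i / real (b i)"
    using eventually_ge_at_top[of 6]
    by eventually_elim (simp add: assms(2) power_one_over)
  ultimately show "(\<lambda>i. real i / real (b i)) \<longlonglongrightarrow> 0"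
    by (rule Lim_transform_eventually)
qed

end
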